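(* Let $1\leq l\leq d-1$. (1) The matrices $\mathfrak{F}^l_{d-1}$ and $\mathfrak{H}^l_{d-1}$ are similar. (2) The matrices $\mathfrak{F}^l_{d-1}$ and $\mathfrak{H}^l_{d-1}$ are diagonalizable with eigenvalue $1$ of multiplicity $l+1$ and eigenvalues $\frac{(l+1)!}{l!},\frac{(l+2)!}{l!},\ldots,\frac{d!}{l!}$, each of multiplicity $1$.
   Context: $\mathfrak{F}^l_{d-1}$ and $\mathfrak{H}^l_{d-1}$ are the real $(d+1)\times(d+1)$ matrices, with rows and columns indexed by $0,\ldots,d$, of the linear transformations sending (as column vectors) the $f$-vector, respectively the $h$-vector, of a $(d-1)$-dimensional simplicial complex $\Delta$ to the $f$-vector, respectively $h$-vector, of its $l$-th partial barycentric subdivision $\mathrm{sd}^l(\Delta)$. Explicitly, $(\mathfrak{F}^l_{d-1})_{ij}=R(j,i,l)$ and $(\mathfrak{H}^l_{d-1})_{ij}=A(d+1,i,d+1-j,l)$, with notation as follows. The $f$-vector of $\Delta$ is $(f_{-1}^\Delta,\ldots,f_{d-1}^\Delta)$ with $f_i^\Delta$ the number of $i$-dimensional faces, and the $h$-vector $(h_0^\Delta,\ldots,h_d^\Delta)$ is defined by $\sum_{i=0}^d f^\Delta_{i-1}(x-1)^{d-i}=\sum_{i=0}^d h_i^\Delta x^{d-i}$. $\mathrm{sd}^l(\Delta)$ is the simplicial complex whose vertices are the vertices of $\Delta$ together with a barycenter for each face $F\in\Delta$ with $\#F\geq l+1$, and whose $(i-1)$-dimensional faces are indexed by strictly increasing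 chains $A_0\subset A_1\subset\cdots\subset A_r$ ($r\ge 0$) of faces of $\Delta$ with $\#A_0\leq l$, $\#A_1\geq l+1$ (if $r\geq1$) and $\#A_0+r=i$; the corresponding face consists of the elements of $A_0$ and the barycenters of $A_1,\ldots,A_r$. $R(j,i,l)$ is the number of ordered systems $|B_0|B_1|\cdots|B_r|$ ($r\geq0$ arbitrary) of pairwise disjoint sets with $B_1,\ldots,B_r\neq\emptyset$ ($B_0$ may be empty) such that $B_0\cup\cdots\cup B_r=[j]$; $\#B_0\leq l$, and if $r\geq1$ then $\#(B_0\cup B_1)\geq l+1$; $\#B_0+r=i$. For $1\leq l\leq m-1$, $S_m^l$ is the set of permutations $\sigma$ of $[m]$ with $\sigma(1)>\cdots>\sigma(l)$; for $\sigma\in S_m^l$, $\mathrm{des}^l(\sigma)$ is the number of $i\in[m-1]$ such that either $i\in[l]$ and $\sigma(i)>\sigma(l+1)$, or $i\in[m-1]\setminus[l]$ and $\sigma(i)>\sigma(i+1)$; and $A(m,i,k,l)$ is the number of $\sigma\in S_m^l$ with $\mathrm{des}^l(\sigma)=i$ and $\sigma(m)=k$. *)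

theory Defs
  imports
    "HOL-Combinatorics.Permutations"
    "HOL-Library.Disjoint_Sets"
    "Jordan_Normal_Form.Char_Poly"
begin

(* Ordered systems |B_0|B_1|...|B_r| are encoded as pairs (B0, Bs) with Bs = [B_1, ..., B_r], so
   r = length Bs.  Disjointness is required position by position. *)

definition ordered_systems :: "nat \<Rightarrow> nat \<Rightarrow> nat \<Rightarrow> (nat set \<times> nat set list) set" where
  "ordered_systems j i l = {(B0, Bs).
     disjoint_family_on (\<lambda>a. (B0 # Bs) ! a) {0..length Bs} \<and>
     (\<forall>B\<in>set Bs. B \<noteq> {}) \<and>
     B0 \<union> \<Union>(set Bs) = {1..j} \<and>
     card B0 \<le> l \<and>
     (length Bs \<ge> 1 \<longrightarrow> card (B0 \<union> Bs ! 0) \<ge> l + 1) \<and>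
     card B0 + length Bs = i}"

lemma finite_ordered_systems: "finite (ordered_systems j i l)"
proof (rule finite_subset)
  show "ordered_systems j i l \<subseteq>
      Pow {1..j} \<times> {Bs. set Bs \<subseteq> Pow {1..j} \<and> length Bs \<le> i}"
  proof (rule subrelI)
    fix B0 Bs
    assume "(B0, Bs) \<in> ordered_systems j i l"
    then have "B0 \<union> \<Union>(set Bs) = {1..j}" and "card B0 + length Bs = i"
      by (simp_all add: ordered_systems_def)
    then have "B0 \<subseteq> {1..j}" and "\<Union>(set Bs) \<subseteq> {1..j}" and "length Bs \<le> i"
      by (blast, blast, linarith)
    then show "(B0, Bs) \<in> Pow {1..j} \<times> {Bs. set Bs \<subseteq> Pow {1..j} \<and> length Bs \<le> i}"
      by blast
  qed
  show "finite (Pow {1..j} \<times> {Bs. set Bs \<subseteq> Pow {1..j} \<and> length Bs \<le> i})"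
    by (intro finite_cartesian_product finite_lists_length_le) auto
qed

(* R_num j i l counts the (i-1)-dimensional faces of the l-th partial barycentric subdivision whose
   chain ends in a fixed face with j vertices: the chain A_0 < ... < A_r corresponds to
   B_0 = A_0 and B_k = A_k - A_(k-1). *)

definition R_num :: "nat \<Rightarrow> nat \<Rightarrow> nat \<Rightarrow> nat" where
  "R_num j i l = card (ordered_systems j i l)"

definition desc_perms :: "nat \<Rightarrow> nat \<Rightarrow> (nat \<Rightarrow> nat) set" where
  "desc_perms m l = {\<sigma>. \<sigma> permutes {1..m} \<and> (\<forall>i\<in>{1..<l}. \<sigma> i > \<sigma> (i + 1))}"

definition des_l :: "nat \<Rightarrow> nat \<Rightarrow> (nat \<Rightarrow> nat) \<Rightarrow> nat" where
  "des_l m l \<sigma> = card {i \<in> {1..m - 1}.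
     (i \<in> {1..l} \<and> \<sigma> i > \<sigma> (l + 1)) \<or> (i \<notin> {1..l} \<and> \<sigma> i > \<sigma> (i + 1))}"

definition A_num :: "nat \<Rightarrow> nat \<Rightarrow> nat \<Rightarrow> nat \<Rightarrow> nat" where
  "A_num m i k l = card {\<sigma> \<in> desc_perms m l. des_l m l \<sigma> = i \<and> \<sigma> m = k}"

(* The matrices of the maps from the f-vector (f_(-1), ..., f_(d-1)), respectively the h-vector
   (h_0, ..., h_d), of a (d-1)-dimensional simplicial complex to that of its l-th partial
   barycentric subdivision, acting on column vectors.  The first argument is d, not the
   dimension d-1. *)

definition F_mat :: "nat \<Rightarrow> nat \<Rightarrow> real mat" where
  "F_mat d l = mat (d + 1) (d + 1) (\<lambda>(i, j). real (R_num j i l))"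

definition H_mat :: "nat \<Rightarrow> nat \<Rightarrow> real mat" where
  "H_mat d l = mat (d + 1) (d + 1) (\<lambda>(i, j). real (A_num (d + 1) i (d + 1 - j) l))"

definition diagonalizable :: "'a :: semiring_1 mat \<Rightarrow> bool" where
  "diagonalizable M \<longleftrightarrow> (\<exists>D. diagonal_mat D \<and> similar_mat M D)"

definition multiplicity_eigenvalue :: "'a :: idom mat \<Rightarrow> 'a \<Rightarrow> nat" where
  "multiplicity_eigenvalue M x = order x (char_poly M)"

end

theory Submission
  imports Defs
begin

text \<open>
  The similarity is a change of basis.  The f-vector depends on the h-vector through the
  unitriangular matrix \<open>h_to_f_mat\<close> with entries \<open>(d - j) choose (d - i)\<close>, and what has to be seen is
  that this matrix intertwines \<open>F_mat\<close> and \<open>H_mat\<close>; entrywise this is the identity \<open>R_num_A_num\<close>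
  between the two counting functions.

  The identity is proved with generating functions in a variable \<open>z\<close>.  On the side of the ordered
  systems, splitting off the last block gives a recurrence for
  \<open>face_poly l j z = (\<Sum>i. R_num j i l * z ^ i)\<close>.  On the side of the permutations, weigh a
  permutation of \<open>d + 1\<close> letters by \<open>z\<close> for every l-descent and by \<open>1 + z\<close> for every l-ascent.
  Expanding \<open>1 + z\<close> chooses at every ascent whether to cut, while descents are always cut; a cut at
  one of the first \<open>l\<close> positions puts its letter into \<open>B0\<close>, and the later cuts separate the blocks.
  In this way a permutation with chosen cuts is an ordered system in which the last block is
  nonempty and has the last letter as its maximum, and \<open>z\<close> counts \<open>B0\<close> and the earlier blocks.  If
  that letter has \<open>t\<close> smaller letters, then removing the last block predicts the total weight
  \<open>\<Sum>c. (t choose c) * face_poly l (d - c) z\<close>, where \<open>c + 1\<close> is the size of that block.  Rather than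
  with the bijection, this prediction is proved by induction: both sides obey the same recurrence
  when the last letter of the word is removed (\<open>last_weight_rec\<close>, \<open>last_block_poly_rec\<close>), and for
  \<open>l + 1\<close> letters the word is determined by its last letter.  Comparing coefficients of \<open>z\<close> yields
  the identity.

  The spectrum is read off from \<open>F_mat\<close>.  A system on \<open>j\<close> points has \<open>card B0 + r \<le> j\<close>, so the matrix is
  upper triangular; for \<open>j \<le> l\<close> there is only one system, so the first \<open>l + 1\<close> columns are those of
  the identity matrix; for \<open>j > l\<close> the diagonal entry is \<open>fact j / fact l\<close>.  These quotients are
  pairwise distinct and different from \<open>1\<close>, hence back substitution produces for every coordinate an
  eigenvector whose last nonzero entry is a \<open>1\<close> in that coordinate
  (\<open>upper_triangular_diagonalizable\<close>).
\<close>

section \<open>Ordered systems\<close>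

text \<open>
  Ordered systems on an arbitrary ground set: removing a block from a system on an initial segment
  leaves a set that is no longer an initial segment.
\<close>

definition systems_on :: "nat \<Rightarrow> nat set \<Rightarrow> nat \<Rightarrow> (nat set \<times> nat set list) set" where
  "systems_on l W i = {(B0, Bs).
     disjoint_family_on (\<lambda>a. (B0 # Bs) ! a) {0..length Bs} \<and>
     (\<forall>B\<in>set Bs. B \<noteq> {}) \<and>
     B0 \<union> \<Union>(set Bs) = W \<and>
     card B0 \<le> l \<and>
     (length Bs \<ge> 1 \<longrightarrow> card (B0 \<union> Bs ! 0) \<ge> l + 1) \<and>
     card B0 + length Bs = i}"

lemma R_num_eq: "R_num j i l = card (systems_on l {1..j} i)"
  by (simp add: R_num_def ordered_systems_def systems_on_def)

lemma finite_systems_on: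
  assumes "finite W"
  shows "finite (systems_on l W i)"
proof (rule finite_subset)
  show "systems_on l W i \<subseteq> Pow W \<times> {Bs. set Bs \<subseteq> Pow W \<and> length Bs \<le> i}"
    by (auto simp: systems_on_def)
  show "finite (Pow W \<times> {Bs. set Bs \<subseteq> Pow W \<and> length Bs \<le> i})"
    using assms by (intro finite_cartesian_product finite_lists_length_le) auto
qed

text \<open>
  If there is a first block \<open>B1\<close>, then \<open>B0\<close> and \<open>B1\<close> together have more than \<open>l\<close> elements, which
  a set with at most \<open>l\<close> elements cannot accommodate.
\<close>

lemma systems_on_small:
  assumes "finite W" "card W \<le> l"
  shows "systems_on l W p = (if p = card W then {(W, [])} else {})"
proof -
  have no_block: "Bs = []" if "(B0, Bs) \<in> systems_on l W p" for B0 Bs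
  proof (rule ccontr)
    assume "Bs \<noteq> []"
    then have "l + 1 \<le> card (B0 \<union> Bs ! 0)" "B0 \<union> Bs ! 0 \<subseteq> W"
      using that by (cases Bs; auto simp: systems_on_def)+
    then show False
      using card_mono[OF assms(1), of "B0 \<union> Bs ! 0"] assms(2) by simp
  qed
  have "(B0, []) \<in> systems_on l W p \<longleftrightarrow> p = card W \<and> B0 = W" for B0
    using assms(2) by (auto simp: systems_on_def disjoint_family_on_def)
  then have "(B0, Bs) \<in> systems_on l W p \<longleftrightarrow> p = card W \<and> B0 = W \<and> Bs = []" for B0 Bs
    using no_block by metis
  then show ?thesis
    by (auto split: prod.splits)
qed

lemma disjoint_blocks_snoc:
  "disjoint_family_on (\<lambda>a. (B0 # Bs @ [B]) ! a) {0..length (Bs @ [B])} \<longleftrightarrow>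
   disjoint_family_on (\<lambda>a. (B0 # Bs) ! a) {0..length Bs} \<and> B \<inter> (B0 \<union> \<Union>(set Bs)) = {}"
proof -
  have nth: "(B0 # Bs @ [B]) ! a = (B0 # Bs) ! a" if "a \<in> {0..length Bs}" for a
    using that nth_append[of "B0 # Bs" "[B]" a] by simp
  have "(\<lambda>a. (B0 # Bs) ! a) ` {0..length Bs} = set (B0 # Bs)"
    by (subst set_conv_nth) (auto simp: image_def less_Suc_eq_le)
  moreover have "(\<lambda>a. (B0 # Bs @ [B]) ! a) ` {0..length Bs} = (\<lambda>a. (B0 # Bs) ! a) ` {0..length Bs}"
    by (rule image_cong[OF refl nth])
  ultimately have un: "(\<Union>a\<in>{0..length Bs}. (B0 # Bs @ [B]) ! a) = B0 \<union> \<Union>(set Bs)"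
    by simp
  have "{0..length (Bs @ [B])} = insert (Suc (length Bs)) {0..length Bs}"
    by auto
  then have "disjoint_family_on (\<lambda>a. (B0 # Bs @ [B]) ! a) {0..length (Bs @ [B])} \<longleftrightarrow>
      B \<inter> (B0 \<union> \<Union>(set Bs)) = {} \<and>
      disjoint_family_on (\<lambda>a. (B0 # Bs @ [B]) ! a) {0..length Bs}"
    using un by (simp add: disjoint_family_on_insert)
  also have "disjoint_family_on (\<lambda>a. (B0 # Bs @ [B]) ! a) {0..length Bs} \<longleftrightarrow>
      disjoint_family_on (\<lambda>a. (B0 # Bs) ! a) {0..length Bs}"
    by (simp add: disjoint_family_on_def nth)
  finally show ?thesis
    by blast
qed

text \<open>
  The cardinality condition concerns only the first block.  Removing the last block therefore
  preserves it, and adding one creates it only when there was no block before, in which case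
  \<open>B0 \<union> B\<close> is all of \<open>W\<close> and the condition is the hypothesis.
\<close>

lemma systems_on_snoc:
  assumes "l < card W"
  shows "(B0, Bs @ [B]) \<in> systems_on l W (Suc p) \<longleftrightarrow>
    B \<noteq> {} \<and> B \<subseteq> W \<and> (B0, Bs) \<in> systems_on l (W - B) p"
proof -
  define U where "U = B0 \<union> \<Union>(set Bs)"
  have un: "B0 \<union> \<Union>(set (Bs @ [B])) = U \<union> B"
    by (auto simp: U_def)
  have key: "B \<inter> U = {} \<and> U \<union> B = W \<longleftrightarrow> B \<subseteq> W \<and> U = W - B"
    by auto
  have cond: "Suc l \<le> card (B0 \<union> (Bs @ [B]) ! 0) \<longleftrightarrow>
      (Suc 0 \<le> length Bs \<longrightarrow> Suc l \<le> card (B0 \<union> Bs ! 0))" if "U \<union> B = W"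
    using that assms by (cases Bs) (simp_all add: U_def)
  show ?thesis
    unfolding systems_on_def mem_Collect_eq prod.case disjoint_blocks_snoc un U_def[symmetric]
    using key cond by (simp (no_asm_simp)) blast
qed

lemma systems_on_large:
  assumes "l < card W"
  shows "systems_on l W 0 = {}"
    and "systems_on l W (Suc p) =
      (\<lambda>(B, B0, Bs). (B0, Bs @ [B])) ` (SIGMA B:Pow W - {{}}. systems_on l (W - B) p)"
proof -
  have no_block: "(B0, []) \<notin> systems_on l W q" for B0 q
    using assms by (auto simp: systems_on_def)
  moreover have "Bs = []" if "(B0, Bs) \<in> systems_on l W 0" for B0 Bs
    using that by (simp add: systems_on_def)
  ultimately show "systems_on l W 0 = {}"
    by fastforce
  show "systems_on l W (Suc p) =
      (\<lambda>(B, B0, Bs). (B0, Bs @ [B])) ` (SIGMA B:Pow W - {{}}. systems_on l (W - B) p)"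
    (is "?L = ?f ` ?R")
  proof (intro equalityI subsetI)
    fix s assume s: "s \<in> ?L"
    obtain B0 Cs where "s = (B0, Cs)"
      by fastforce
    moreover from this s no_block obtain Bs B where "Cs = Bs @ [B]"
      by (cases Cs rule: rev_cases) auto
    ultimately have "s = ?f (B, B0, Bs)" "(B, B0, Bs) \<in> ?R"
      using s systems_on_snoc[OF assms] by auto
    then show "s \<in> ?f ` ?R"
      by blast
  next
    fix s assume "s \<in> ?f ` ?R"
    then show "s \<in> ?L"
      using systems_on_snoc[OF assms] by auto
  qed
qed

lemma card_systems_on_Suc:
  assumes "finite W" "l < card W"
  shows "card (systems_on l W (Suc p)) = (\<Sum>C\<in>Pow W - {W}. card (systems_on l C p))"
proof -
  have "inj (\<lambda>(B, B0, Bs). (B0, Bs @ [B]))"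
    by (auto simp: inj_def)
  then have "card (systems_on l W (Suc p)) =
      card (SIGMA B:Pow W - {{}}. systems_on l (W - B) p)"
    unfolding systems_on_large(2)[OF assms(2)] by (intro card_image) (blast intro: inj_on_subset)
  also have "\<dots> = (\<Sum>B\<in>Pow W - {{}}. card (systems_on l (W - B) p))"
    using assms(1) by (intro card_SigmaI) (auto intro: finite_systems_on)
  also have "\<dots> = (\<Sum>C\<in>Pow W - {W}. card (systems_on l C p))"
    by (rule sum.reindex_bij_witness[of _ "\<lambda>C. W - C" "\<lambda>C. W - C"]) (auto simp: double_diff)
  finally show ?thesis .
qed

lemma sum_proper_subsets_by_card:
  fixes f :: "nat \<Rightarrow> nat"
  assumes "finite W"
  shows "(\<Sum>C\<in>Pow W - {W}. f (card C)) = (\<Sum>c<card W. (card W choose c) * f c)"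
proof -
  have "(\<Sum>C\<in>Pow W - {W}. f (card C)) =
      (\<Sum>c<card W. \<Sum>C\<in>{C \<in> Pow W - {W}. card C = c}. f (card C))"
    using assms by (intro sum.group[symmetric]) (auto intro: psubset_card_mono)
  also have "\<dots> = (\<Sum>c<card W. (card W choose c) * f c)"
  proof (rule sum.cong[OF refl])
    fix c assume "c \<in> {..<card W}"
    then have "{C \<in> Pow W - {W}. card C = c} = {C. C \<subseteq> W \<and> card C = c}"
      by auto
    then show "(\<Sum>C\<in>{C \<in> Pow W - {W}. card C = c}. f (card C)) = (card W choose c) * f c"
      using n_subsets[OF assms, of c] by simp
  qed
  finally show ?thesis .
qed

text \<open>
  Induction on \<open>p\<close>: by the induction hypothesis the right-hand side of the recurrence depends on the
  ground set only through its cardinality.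
\<close>

lemma card_systems_on:
  fixes W :: "nat set"
  assumes "finite W"
  shows "card (systems_on l W p) = R_num (card W) p l"
  using assms
proof (induction p arbitrary: W)
  case 0
  then show ?case
    by (cases "card W \<le> l") (simp_all add: R_num_eq systems_on_small systems_on_large)
next
  case (Suc p)
  have rec: "card (systems_on l V (Suc p)) = (\<Sum>c<card V. (card V choose c) * R_num c p l)"
    if V: "finite V" "l < card V" for V :: "nat set"
  proof -
    have "card (systems_on l V (Suc p)) = (\<Sum>C\<in>Pow V - {V}. R_num (card C) p l)"
      unfolding card_systems_on_Suc[OF V]
      using V(1) by (intro sum.cong) (auto intro: Suc.IH finite_subset)
    then show ?thesis
      using sum_proper_subsets_by_card[OF V(1), of "\<lambda>c. R_num c p l"] by simp
  qed
  show ?case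
  proof (cases "card W \<le> l")
    case True
    then show ?thesis
      using Suc.prems by (simp add: R_num_eq systems_on_small)
  next
    case False
    then show ?thesis
      using rec[of W] rec[of "{1..card W}"] Suc.prems by (simp add: R_num_eq)
  qed
qed

lemma R_num_small: "j \<le> l \<Longrightarrow> R_num j i l = (if i = j then 1 else 0)"
  by (simp add: R_num_eq systems_on_small)

lemma R_num_0: "l < j \<Longrightarrow> R_num j 0 l = 0"
  by (simp add: R_num_eq systems_on_large)

lemma R_num_Suc:
  assumes "l < j"
  shows "R_num j (Suc i) l = (\<Sum>c<j. (j choose c) * R_num c i l)"
proof -
  have "R_num j (Suc i) l = (\<Sum>C\<in>Pow {1..j} - {{1..j}}. R_num (card C) i l)"
    unfolding R_num_eq[of j] using assms
    by (subst card_systems_on_Suc) (auto intro!: sum.cong card_systems_on intro: finite_subset)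
  then show ?thesis
    using sum_proper_subsets_by_card[of "{1..j}" "\<lambda>c. R_num c i l"] by simp
qed

lemma R_num_eq_0: "j < i \<Longrightarrow> R_num j i l = 0"
proof (induction i arbitrary: j)
  case (Suc i)
  then show ?case
    by (cases "j \<le> l") (simp_all add: R_num_small R_num_Suc)
qed simp

text \<open>
  In the recurrence for \<open>R_num (j + 1) (j + 1) l\<close> only the summand for a last block with a single
  element survives, and there are \<open>j + 1\<close> of these blocks.
\<close>

lemma R_num_diag:
  assumes "l \<le> j"
  shows "R_num j j l * fact l = fact j"
  using assms
proof (induction j rule: dec_induct)
  case base
  then show ?case
    by (simp add: R_num_small)
next
  case (step j)
  have "R_num (Suc j) (Suc j) l = (\<Sum>c<Suc j. (Suc j choose c) * R_num c j l)"
    using step by (intro R_num_Suc) simp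
  also have "\<dots> = Suc j * R_num j j l"
    by (simp add: R_num_eq_0)
  finally show ?case
    using step.IH by (simp add: algebra_simps)
qed

definition face_poly :: "nat \<Rightarrow> nat \<Rightarrow> real \<Rightarrow> real" where
  "face_poly l j z = (\<Sum>i\<le>j. real (R_num j i l) * z ^ i)"

lemma face_poly_eq_sum_atMost:
  assumes "j \<le> n"
  shows "face_poly l j z = (\<Sum>i\<le>n. real (R_num j i l) * z ^ i)"
  unfolding face_poly_def using assms
  by (intro sum.mono_neutral_left) (auto simp: R_num_eq_0)

lemma face_poly_small:
  assumes "j \<le> l"
  shows "face_poly l j z = z ^ j"
proof -
  have "face_poly l j z = (\<Sum>i\<le>j. if i = j then z ^ i else 0)"
    unfolding face_poly_def using assms by (intro sum.cong) (auto simp: R_num_small)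
  then show ?thesis
    by simp
qed

lemma face_poly_rec:
  assumes "l < j"
  shows "face_poly l j z = z * (\<Sum>c<j. real (j choose c) * face_poly l c z)"
proof -
  obtain m where j: "j = Suc m"
    using assms by (cases j) auto
  have "face_poly l j z = (\<Sum>i\<le>m. real (R_num j (Suc i) l) * z ^ Suc i)"
    unfolding face_poly_def j sum.atMost_Suc_shift using assms j by (simp add: R_num_0)
  also have "\<dots> = z * (\<Sum>i\<le>m. \<Sum>c<j. real (j choose c) * (real (R_num c i l) * z ^ i))"
    by (simp add: R_num_Suc[OF assms] sum_distrib_left sum_distrib_right mult_ac)
  also have "\<dots> = z * (\<Sum>c<j. \<Sum>i\<le>m. real (j choose c) * (real (R_num c i l) * z ^ i))"
    by (subst sum.swap) simp
  also have "\<dots> = z * (\<Sum>c<j. real (j choose c) * face_poly l c z)"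
  proof -
    have "face_poly l c z = (\<Sum>i\<le>m. real (R_num c i l) * z ^ i)" if "c < j" for c
      using that j by (intro face_poly_eq_sum_atMost) simp
    then show ?thesis
      by (simp add: sum_distrib_left)
  qed
  finally show ?thesis .
qed

section \<open>Words with a decreasing prefix\<close>

text \<open>
  Words of length \<open>n\<close> in the letters \<open>V\<close> without repetition, encoded as functions that are the
  identity outside the positions.  With this convention the case \<open>V = {1..n}\<close> is literally the set of
  permutations \<open>desc_perms\<close>, and removing the last letter is a function update.
\<close>

definition arrangements :: "nat \<Rightarrow> nat set \<Rightarrow> nat \<Rightarrow> (nat \<Rightarrow> nat) set" where
  "arrangements l V n = {\<sigma>. bij_betw \<sigma> {1..n} V \<and> (\<forall>x. x \<notin> {1..n} \<longrightarrow> \<sigma> x = x) \<and>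
     (\<forall>i\<in>{1..<l}. \<sigma> i > \<sigma> (i + 1))}"

lemma desc_perms_eq: "desc_perms m l = arrangements l {1..m} m"
proof -
  have "\<sigma> permutes {1..m} \<longleftrightarrow> bij_betw \<sigma> {1..m} {1..m} \<and> (\<forall>x. x \<notin> {1..m} \<longrightarrow> \<sigma> x = x)" for \<sigma>
  proof
    assume "\<sigma> permutes {1..m}"
    then show "bij_betw \<sigma> {1..m} {1..m} \<and> (\<forall>x. x \<notin> {1..m} \<longrightarrow> \<sigma> x = x)"
      by (simp add: permutes_imp_bij permutes_not_in del: atLeastAtMost_iff)
  next
    assume "bij_betw \<sigma> {1..m} {1..m} \<and> (\<forall>x. x \<notin> {1..m} \<longrightarrow> \<sigma> x = x)"
    then show "\<sigma> permutes {1..m}"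
      by (intro bij_imp_permutes) simp_all
  qed
  then show ?thesis
    by (simp add: desc_perms_def arrangements_def)
qed

lemma finite_arrangements:
  assumes "finite V"
  shows "finite (arrangements l V n)"
proof (rule finite_imageD)
  have "(\<lambda>\<sigma>. restrict \<sigma> {1..n}) ` arrangements l V n \<subseteq> {1..n} \<rightarrow>\<^sub>E V"
    by (auto simp: arrangements_def dest: bij_betwE)
  then show "finite ((\<lambda>\<sigma>. restrict \<sigma> {1..n}) ` arrangements l V n)"
    by (rule finite_subset) (intro finite_PiE, use assms in auto)
  show "inj_on (\<lambda>\<sigma>. restrict \<sigma> {1..n}) (arrangements l V n)"
  proof (intro inj_onI ext)
    fix \<sigma> \<tau> x
    assume "\<sigma> \<in> arrangements l V n" "\<tau> \<in> arrangements l V n"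
      "restrict \<sigma> {1..n} = restrict \<tau> {1..n}"
    then show "\<sigma> x = \<tau> x"
      by (cases "x \<in> {1..n}") (auto simp: arrangements_def dest: fun_cong[of _ _ x])
  qed
qed

lemma bij_betw_append_letter:
  assumes k: "k \<in> V" and l: "l \<le> n"
  shows "bij_betw (\<lambda>\<sigma>. \<sigma>(Suc n := k)) (arrangements l (V - {k}) n)
    {\<sigma> \<in> arrangements l V (Suc n). \<sigma> (Suc n) = k}"
proof (rule bij_betw_byWitness[where f' = "\<lambda>\<sigma>. \<sigma>(Suc n := Suc n)"])
  show "\<forall>\<sigma>\<in>arrangements l (V - {k}) n. (\<sigma>(Suc n := k))(Suc n := Suc n) = \<sigma>"
    by (auto simp: arrangements_def)
  show "\<forall>\<sigma>\<in>{\<sigma> \<in> arrangements l V (Suc n). \<sigma> (Suc n) = k}.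
      (\<sigma>(Suc n := Suc n))(Suc n := k) = \<sigma>"
    by auto
  show "(\<lambda>\<sigma>. \<sigma>(Suc n := k)) ` arrangements l (V - {k}) n
      \<subseteq> {\<sigma> \<in> arrangements l V (Suc n). \<sigma> (Suc n) = k}"
  proof (rule image_subsetI)
    fix \<sigma> assume \<sigma>: "\<sigma> \<in> arrangements l (V - {k}) n"
    have "bij_betw (\<sigma>(Suc n := k)) {1..n} (V - {k})"
      using \<sigma> by (subst bij_betw_cong[of _ _ \<sigma>]) (auto simp: arrangements_def)
    then have "bij_betw (\<sigma>(Suc n := k)) ({1..n} \<union> {Suc n}) (V - {k} \<union> {k})"
      using notIn_Un_bij_betw3[of "Suc n" "{1..n}" "\<sigma>(Suc n := k)" "V - {k}"] by simp
    moreover have "V - {k} \<union> {k} = V" "{1..n} \<union> {Suc n} = {1..Suc n}"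
      using k by auto
    ultimately show "\<sigma>(Suc n := k) \<in> {\<sigma> \<in> arrangements l V (Suc n). \<sigma> (Suc n) = k}"
      using \<sigma> l by (auto simp: arrangements_def)
  qed
  show "(\<lambda>\<sigma>. \<sigma>(Suc n := Suc n)) ` {\<sigma> \<in> arrangements l V (Suc n). \<sigma> (Suc n) = k}
      \<subseteq> arrangements l (V - {k}) n"
  proof (rule image_subsetI)
    fix \<sigma> assume \<sigma>: "\<sigma> \<in> {\<sigma> \<in> arrangements l V (Suc n). \<sigma> (Suc n) = k}"
    moreover have "V - {k} \<union> {k} = V" "{1..n} \<union> {Suc n} = {1..Suc n}"
      using k by auto
    ultimately have "bij_betw \<sigma> {1..n} (V - {k})"
      using notIn_Un_bij_betw3[of "Suc n" "{1..n}" \<sigma> "V - {k}"] by (simp add: arrangements_def)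
    then have "bij_betw (\<sigma>(Suc n := Suc n)) {1..n} (V - {k})"
      by (subst bij_betw_cong[of _ _ \<sigma>]) auto
    then show "\<sigma>(Suc n := Suc n) \<in> arrangements l (V - {k}) n"
      using \<sigma> l by (auto simp: arrangements_def)
  qed
qed

text \<open>
  The last letter of a decreasing word is the minimum of its letters.
\<close>

lemma card_decreasing_arrangements:
  assumes "finite V" "card V = n"
  shows "card (arrangements n V n) = 1"
  using assms
proof (induction n arbitrary: V)
  case 0
  then have "arrangements 0 V 0 = {\<lambda>x. x}"
    by (auto simp: arrangements_def bij_betw_def)
  then show ?case
    by simp
next
  case (Suc n)
  define k where "k = Min V"
  have "V \<noteq> {}"
    using Suc.prems by auto
  then have k: "k \<in> V"
    using Suc.prems Min_in[of V] by (simp add: k_def)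
  have "arrangements (Suc n) V (Suc n) = {\<sigma> \<in> arrangements n V (Suc n). \<sigma> (Suc n) = k}"
  proof (intro equalityI subsetI)
    fix \<sigma> assume \<sigma>: "\<sigma> \<in> arrangements (Suc n) V (Suc n)"
    have le: "\<sigma> (Suc n) \<le> \<sigma> i" if "1 \<le> i" "i \<le> Suc n" for i
      using that(2,1)
    proof (induction i rule: inc_induct)
      case (step i)
      then have "\<sigma> (Suc i) < \<sigma> i"
        using \<sigma> by (auto simp: arrangements_def)
      then show ?case
        using step by simp
    qed simp
    have bij: "bij_betw \<sigma> {1..Suc n} V"
      using \<sigma> by (simp add: arrangements_def)
    have "\<sigma> (Suc n) = Min V"
    proof (rule Min_eqI[symmetric])
      show "\<sigma> (Suc n) \<le> v" if "v \<in> V" for v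
        using that le bij unfolding bij_betw_def by auto
      show "\<sigma> (Suc n) \<in> V"
        using bij by (auto dest: bij_betwE)
    qed (fact Suc.prems(1))
    then show "\<sigma> \<in> {\<sigma> \<in> arrangements n V (Suc n). \<sigma> (Suc n) = k}"
      using \<sigma> by (auto simp: arrangements_def k_def)
  next
    fix \<sigma> assume \<sigma>: "\<sigma> \<in> {\<sigma> \<in> arrangements n V (Suc n). \<sigma> (Suc n) = k}"
    have "\<sigma> (Suc n) < \<sigma> n" if "1 \<le> n"
    proof -
      have "bij_betw \<sigma> {1..Suc n} V"
        using \<sigma> by (simp add: arrangements_def)
      then have "\<sigma> n \<in> V" "\<sigma> n \<noteq> \<sigma> (Suc n)"
        using that by (auto simp: bij_betw_def dest: inj_onD)
      then show ?thesis
        using \<sigma> Min_le[OF Suc.prems(1), of "\<sigma> n"] by (simp add: k_def)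
    qed
    then have "\<forall>i\<in>{1..<Suc n}. \<sigma> i > \<sigma> (i + 1)"
      using \<sigma> by (auto simp: arrangements_def less_Suc_eq)
    then show "\<sigma> \<in> arrangements (Suc n) V (Suc n)"
      using \<sigma> by (simp add: arrangements_def)
  qed
  then have "card (arrangements (Suc n) V (Suc n)) = card (arrangements n (V - {k}) n)"
    using bij_betw_same_card[OF bij_betw_append_letter[OF k order_refl, of n]] by simp
  then show ?case
    using Suc k by simp
qed

definition l_descent :: "nat \<Rightarrow> (nat \<Rightarrow> nat) \<Rightarrow> nat \<Rightarrow> bool" where
  "l_descent l \<sigma> i \<longleftrightarrow> (i \<in> {1..l} \<and> \<sigma> i > \<sigma> (l + 1)) \<or> (i \<notin> {1..l} \<and> \<sigma> i > \<sigma> (i + 1))"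

text \<open>
  With one factor for each position, appending a letter multiplies the weight by a single factor.
\<close>

definition weight :: "nat \<Rightarrow> real \<Rightarrow> nat \<Rightarrow> (nat \<Rightarrow> nat) \<Rightarrow> real" where
  "weight l z n \<sigma> = (\<Prod>i\<in>{1..n - 1}. if l_descent l \<sigma> i then z else 1 + z)"

lemma weight_eq_des:
  "weight l z n \<sigma> = z ^ des_l n l \<sigma> * (1 + z) ^ (n - 1 - des_l n l \<sigma>)"
proof -
  let ?D = "{i \<in> {1..n - 1}. l_descent l \<sigma> i}"
  have des: "des_l n l \<sigma> = card ?D"
    by (simp add: des_l_def l_descent_def)
  have "{1..n - 1} \<inter> - {i. l_descent l \<sigma> i} = {1..n - 1} - ?D"
    by auto
  moreover have "card ({1..n - 1} - ?D) = card {1..n - 1} - card ?D"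
    by (rule card_Diff_subset) auto
  ultimately have "card ({1..n - 1} \<inter> - {i. l_descent l \<sigma> i}) = n - 1 - card ?D"
    by (simp only: card_atLeastAtMost) simp
  moreover have "{1..n - 1} \<inter> {i. l_descent l \<sigma> i} = ?D"
    by auto
  ultimately show ?thesis
    by (simp add: weight_def des prod.If_cases)
qed

lemma weight_append_letter:
  assumes "l < n"
  shows "weight l z (Suc n) (\<sigma>(Suc n := k)) = weight l z n \<sigma> * (if \<sigma> n > k then z else 1 + z)"
proof -
  have "{1..n} = insert n {1..n - 1}" "n \<notin> {1..n - 1}"
    using assms by auto
  moreover have "l_descent l (\<sigma>(Suc n := k)) i = l_descent l \<sigma> i" if "i \<in> {1..n - 1}" for i
    using that assms by (auto simp: l_descent_def)
  moreover have "l_descent l (\<sigma>(Suc n := k)) n \<longleftrightarrow> \<sigma> n > k"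
    using assms by (simp add: l_descent_def)
  ultimately show ?thesis
    unfolding weight_def diff_Suc_1 by (simp add: mult.commute cong: prod.cong_simp del: One_nat_def)
qed

text \<open>
  When the word has only one letter after the decreasing prefix, every prefix letter is compared
  with that letter alone, so the weight does not depend on the order of the prefix.
\<close>

lemma weight_append_letter_base:
  assumes "\<sigma> \<in> arrangements l V l"
  shows "weight l z (Suc l) (\<sigma>(Suc l := k)) = (\<Prod>v\<in>V. if v > k then z else 1 + z)"
proof -
  have "weight l z (Suc l) (\<sigma>(Suc l := k)) = (\<Prod>i\<in>{1..l}. if \<sigma> i > k then z else 1 + z)"
    unfolding weight_def by (rule prod.cong) (auto simp: l_descent_def)
  also have "\<dots> = (\<Prod>v\<in>V. if v > k then z else 1 + z)"
    using assms by (intro prod.reindex_bij_betw) (simp add: arrangements_def)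
  finally show ?thesis .
qed

definition last_weight :: "nat \<Rightarrow> real \<Rightarrow> nat set \<Rightarrow> nat \<Rightarrow> nat \<Rightarrow> real" where
  "last_weight l z V n k = (\<Sum>\<sigma>\<in>{\<sigma> \<in> arrangements l V n. \<sigma> n = k}. weight l z n \<sigma>)"

lemma last_weight_base:
  assumes V: "finite V" "card V = Suc l" and k: "k \<in> V"
  shows "last_weight l z V (Suc l) k = z ^ (l - card {v \<in> V. v < k}) * (1 + z) ^ card {v \<in> V. v < k}"
proof -
  let ?V = "V - {k}" and ?t = "card {v \<in> V. v < k}"
  have "last_weight l z V (Suc l) k =
      (\<Sum>\<sigma>\<in>arrangements l ?V l. weight l z (Suc l) (\<sigma>(Suc l := k)))"
    unfolding last_weight_def
    by (rule sum.reindex_bij_betw[OF bij_betw_append_letter[OF k order_refl], symmetric])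
  also have "\<dots> = (\<Prod>v\<in>?V. if v > k then z else 1 + z)"
    using card_decreasing_arrangements[of ?V l] V k by (simp add: weight_append_letter_base)
  also have "\<dots> = z ^ (l - ?t) * (1 + z) ^ ?t"
  proof -
    have lt: "?V \<inter> - {v. k < v} = {v \<in> V. v < k}" and gt: "?V \<inter> {v. k < v} = ?V - {v \<in> V. v < k}"
      by auto
    have "card (?V - {v \<in> V. v < k}) = l - ?t"
      using V k by (subst card_Diff_subset) auto
    then show ?thesis
      using V by (subst prod.If_cases) (simp_all only: lt gt prod_constant finite_Diff)
  qed
  finally show ?thesis .
qed

lemma last_weight_rec:
  assumes V: "finite V" and k: "k \<in> V" and n: "l < n"
  shows "last_weight l z V (Suc n) k =
    (\<Sum>k'\<in>V - {k}. (if k' > k then z else 1 + z) * last_weight l z (V - {k}) n k')"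
proof -
  let ?A = "arrangements l (V - {k}) n"
  have "last_weight l z V (Suc n) k = (\<Sum>\<sigma>\<in>?A. weight l z (Suc n) (\<sigma>(Suc n := k)))"
    unfolding last_weight_def using n
    by (intro sum.reindex_bij_betw[OF bij_betw_append_letter[OF k], symmetric]) simp
  also have "\<dots> = (\<Sum>\<sigma>\<in>?A. weight l z n \<sigma> * (if \<sigma> n > k then z else 1 + z))"
    using n by (simp only: weight_append_letter)
  also have "\<dots> = (\<Sum>k'\<in>V - {k}. \<Sum>\<sigma>\<in>{\<sigma> \<in> ?A. \<sigma> n = k'}.
      weight l z n \<sigma> * (if \<sigma> n > k then z else 1 + z))"
  proof (rule sum.group[symmetric])
    show "(\<lambda>\<sigma>. \<sigma> n) ` ?A \<subseteq> V - {k}"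
      using n unfolding arrangements_def by (auto dest!: bij_betwE)
  qed (use V in \<open>auto intro: finite_arrangements\<close>)
  also have "\<dots> = (\<Sum>k'\<in>V - {k}. (if k' > k then z else 1 + z) * last_weight l z (V - {k}) n k')"
    unfolding last_weight_def sum_distrib_left
    by (intro sum.cong) (auto simp: mult.commute)
  finally show ?thesis .
qed

lemma rank_less:
  fixes V :: "nat set"
  assumes "finite V" "a \<in> V" "a < b"
  shows "card {v \<in> V. v < a} < card {v \<in> V. v < b}"
proof (rule psubset_card_mono)
  have "a \<in> {v \<in> V. v < b}" "a \<notin> {v \<in> V. v < a}" "{v \<in> V. v < a} \<subseteq> {v \<in> V. v < b}"
    using assms by auto
  then show "{v \<in> V. v < a} \<subset> {v \<in> V. v < b}"
    by blast
qed (use assms in simp)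

text \<open>
  This turns sums over letters of a quantity that depends on the rank alone into sums over an
  initial segment.
\<close>

lemma bij_betw_rank:
  fixes V :: "nat set"
  assumes V: "finite V"
  shows "bij_betw (\<lambda>k. card {v \<in> V. v < k}) V {..<card V}"
proof -
  have inj: "inj_on (\<lambda>k. card {v \<in> V. v < k}) V"
  proof (rule inj_onI)
    fix a b assume "a \<in> V" "b \<in> V" "card {v \<in> V. v < a} = card {v \<in> V. v < b}"
    then show "a = b"
      using rank_less[OF V, of a b] rank_less[OF V, of b a] by (cases a b rule: linorder_cases) auto
  qed
  moreover have "(\<lambda>k. card {v \<in> V. v < k}) ` V \<subseteq> {..<card V}"
    using V by (auto intro!: psubset_card_mono)
  ultimately have "(\<lambda>k. card {v \<in> V. v < k}) ` V = {..<card V}"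
    by (intro card_subset_eq) (simp_all add: card_image)
  with inj show ?thesis
    by (simp add: bij_betw_def)
qed

section \<open>Weighted words and ordered systems\<close>

text \<open>
  The generating function of the ordered systems on \<open>n\<close> points whose last block is nonempty and has
  a maximum with exactly \<open>t\<close> smaller points, that last block not contributing to the exponent: the
  other elements of the block are \<open>c\<close> of these \<open>t\<close> points, and \<open>n - 1 - c\<close> points remain.
\<close>

definition last_block_poly :: "nat \<Rightarrow> nat \<Rightarrow> nat \<Rightarrow> real \<Rightarrow> real" where
  "last_block_poly l n t z = (\<Sum>c\<le>t. real (t choose c) * face_poly l (n - 1 - c) z)"

lemma sum_binomial_power_diff:
  fixes z :: real
  assumes "t \<le> n"
  shows "(\<Sum>c\<le>t. real (t choose c) * z ^ (n - c)) = z ^ (n - t) * (1 + z) ^ t"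
proof -
  have "z ^ (n - t) * (1 + z) ^ t = (\<Sum>c\<le>t. real (t choose c) * (z ^ (n - t) * z ^ (t - c)))"
    by (simp add: binomial_ring sum_distrib_left mult_ac)
  also have "\<dots> = (\<Sum>c\<le>t. real (t choose c) * z ^ (n - c))"
    using assms by (intro sum.cong) (simp_all flip: power_add)
  finally show ?thesis ..
qed

text \<open>
  The hockey-stick identity: among the subsets of \<open>{..<t}\<close> with \<open>Suc c\<close> elements, those with maximum \<open>s\<close>
  are counted by \<open>s choose c\<close>.
\<close>

lemma sum_last_block_poly:
  "(\<Sum>s<t. last_block_poly l n s z) = (\<Sum>c<t. real (t choose Suc c) * face_poly l (n - 1 - c) z)"
proof (induction t)
  case (Suc t)
  have "(\<Sum>c<t. real (t choose Suc c) * face_poly l (n - 1 - c) z)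
      = (\<Sum>c\<le>t. real (t choose Suc c) * face_poly l (n - 1 - c) z)"
    by (simp add: lessThan_Suc_atMost[symmetric])
  then have "(\<Sum>s<Suc t. last_block_poly l n s z) =
      (\<Sum>c\<le>t. real (t choose Suc c) * face_poly l (n - 1 - c) z) +
      (\<Sum>c\<le>t. real (t choose c) * face_poly l (n - 1 - c) z)"
    unfolding sum.lessThan_Suc Suc.IH by (simp add: last_block_poly_def)
  also have "\<dots> = (\<Sum>c\<le>t. real (Suc t choose Suc c) * face_poly l (n - 1 - c) z)"
    by (simp add: algebra_simps flip: sum.distrib)
  finally show ?case
    by (simp only: lessThan_Suc_atMost)
qed simp

text \<open>
  The recurrence of \<open>face_poly\<close>, with the last block classified by its maximum.
\<close>

lemma face_poly_eq_sum_last_block_poly: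
  assumes "l < n"
  shows "face_poly l n z = z * (\<Sum>s<n. last_block_poly l n s z)"
proof -
  have "(\<Sum>c<n. real (n choose c) * face_poly l c z)
      = (\<Sum>c<n. real (n choose (n - Suc c)) * face_poly l (n - Suc c) z)"
    by (rule sum.nat_diff_reindex[symmetric])
  also have "\<dots> = (\<Sum>c<n. real (n choose Suc c) * face_poly l (n - 1 - c) z)"
    by (intro sum.cong) (auto simp: binomial_symmetric[of "Suc _"])
  finally show ?thesis
    using face_poly_rec[OF assms] by (simp add: sum_last_block_poly)
qed

text \<open>
  Either the last block consists of its maximum only, and the rest is an arbitrary system; or,
  after the maximum is removed, the new maximum of the block is a point with \<open>s < t\<close> smaller ones.
  The first case contributes \<open>z\<close> for every \<open>s < n\<close> and the second adds \<open>1\<close> for \<open>s < t\<close>.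
\<close>

lemma last_block_poly_rec:
  assumes "l < n" "t \<le> n"
  shows "last_block_poly l (Suc n) t z =
    (\<Sum>s<n. (if t \<le> s then z else 1 + z) * last_block_poly l n s z)"
proof -
  have "last_block_poly l (Suc n) t z =
      face_poly l n z + (\<Sum>c<t. real (t choose Suc c) * face_poly l (n - 1 - c) z)"
    by (simp add: last_block_poly_def sum.atMost_shift)
  also have "\<dots> = (\<Sum>s<n. z * last_block_poly l n s z) + (\<Sum>s<t. last_block_poly l n s z)"
    by (simp only: face_poly_eq_sum_last_block_poly[OF assms(1)] sum_distrib_left
        sum_last_block_poly[where t = t])
  also have "(\<Sum>s<t. last_block_poly l n s z) = (\<Sum>s<n. if s < t then last_block_poly l n s z else 0)"
  proof -
    have "{..<n} \<inter> {s. s < t} = {..<t}"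
      using assms by auto
    then show ?thesis
      by (subst sum.If_cases) simp_all
  qed
  also have "(\<Sum>s<n. z * last_block_poly l n s z) + \<dots> =
      (\<Sum>s<n. (if t \<le> s then z else 1 + z) * last_block_poly l n s z)"
    unfolding sum.distrib[symmetric] by (intro sum.cong) (auto simp: algebra_simps)
  finally show ?thesis .
qed

text \<open>
  The central induction, on the length of the word.  It starts at \<open>n = l + 1\<close> because below this
  length the l-descents refer to a position outside the word.
\<close>

lemma last_weight_eq_last_block_poly:
  assumes "l < n" "finite V" "card V = n" "k \<in> V"
  shows "last_weight l z V n k = last_block_poly l n (card {v \<in> V. v < k}) z"
proof -
  have "Suc l \<le> n"
    using assms by simp
  then show ?thesis
    using assms(2-4)
  proof (induction n arbitrary: V k rule: dec_induct)
    case base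
    have "card {v \<in> V. v < k} \<le> card (V - {k})"
      using base by (intro card_mono) auto
    then have t: "card {v \<in> V. v < k} \<le> l"
      using base by simp
    then show ?case
      using base
      by (simp add: last_weight_base last_block_poly_def face_poly_small sum_binomial_power_diff)
  next
    case (step n)
    let ?V = "V - {k}"
    define r where "r = (\<lambda>i. card {v \<in> ?V. v < i})"
    have V: "finite ?V" "card ?V = n"
      using step.prems by auto
    have "{v \<in> V. v < k} = {v \<in> ?V. v < k}"
      by auto
    then have t: "card {v \<in> V. v < k} = r k"
      by (simp only: r_def)
    have bij: "bij_betw r ?V {..<n}"
      unfolding r_def V(2)[symmetric] by (rule bij_betw_rank[OF V(1)])
    have less: "r k \<le> r i \<longleftrightarrow> k < i" if "i \<in> ?V" for i
    proof
      assume "k < i"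
      then show "r k \<le> r i"
        unfolding r_def using V(1) by (intro card_mono) auto
    next
      assume le: "r k \<le> r i"
      show "k < i"
      proof (rule ccontr)
        assume "\<not> k < i"
        then have "i < k"
          using that by simp
        then have "r i < r k"
          unfolding r_def by (rule rank_less[OF V(1) that])
        then show False
          using le by simp
      qed
    qed
    have "r k \<le> card ?V"
      unfolding r_def by (rule card_mono[OF V(1)]) auto
    then have "r k \<le> n"
      by (simp only: V(2))
    moreover have "l < n"
      using step.hyps by simp
    ultimately have "last_block_poly l (Suc n) (r k) z =
        (\<Sum>s<n. (if r k \<le> s then z else 1 + z) * last_block_poly l n s z)"
      by (intro last_block_poly_rec)
    also have "\<dots> = (\<Sum>i\<in>?V. (if r k \<le> r i then z else 1 + z) * last_block_poly l n (r i) z)"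
      by (rule sum.reindex_bij_betw[OF bij, symmetric])
    also have "\<dots> = (\<Sum>i\<in>?V. (if k < i then z else 1 + z) * last_weight l z ?V n i)"
    proof (rule sum.cong[OF refl])
      fix i assume i: "i \<in> ?V"
      have "last_weight l z ?V n i = last_block_poly l n (r i) z"
        unfolding r_def by (rule step.IH[OF V i])
      then show "(if r k \<le> r i then z else 1 + z) * last_block_poly l n (r i) z =
          (if k < i then z else 1 + z) * last_weight l z ?V n i"
        by (simp only: less[OF i])
    qed
    also have "\<dots> = last_weight l z V (Suc n) k"
      using step by (intro last_weight_rec[symmetric]) auto
    finally show ?case
      unfolding t by (rule sym)
  qed
qed

lemma last_weight_eq_A_num:
  "last_weight l z {1..d + 1} (d + 1) k =
    (\<Sum>i\<le>d. real (A_num (d + 1) i k l) * (z ^ i * (1 + z) ^ (d - i)))"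
proof -
  let ?S = "{\<sigma> \<in> arrangements l {1..d + 1} (d + 1). \<sigma> (d + 1) = k}"
  have "des_l (d + 1) l \<sigma> \<le> d" for \<sigma>
    unfolding des_l_def by (rule order.trans[OF card_mono[of "{1..d}"]]) auto
  then have "last_weight l z {1..d + 1} (d + 1) k =
      (\<Sum>i\<le>d. \<Sum>\<sigma>\<in>{\<sigma> \<in> ?S. des_l (d + 1) l \<sigma> = i}. weight l z (d + 1) \<sigma>)"
    unfolding last_weight_def
    by (intro sum.group[symmetric]) (auto intro: finite_subset[OF _ finite_arrangements])
  also have "\<dots> = (\<Sum>i\<le>d. \<Sum>\<sigma>\<in>{\<sigma> \<in> ?S. des_l (d + 1) l \<sigma> = i}. z ^ i * (1 + z) ^ (d - i))"
    by (intro sum.cong) (auto simp: weight_eq_des)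
  also have "\<dots> = (\<Sum>i\<le>d. real (A_num (d + 1) i k l) * (z ^ i * (1 + z) ^ (d - i)))"
    by (simp add: A_num_def desc_perms_eq conj_ac)
  finally show ?thesis .
qed

text \<open>
  For the last letter \<open>d + 1 - j\<close> there are \<open>d - j\<close> smaller letters, so the left-hand side collects
  the coefficients of \<open>last_block_poly l (d + 1) (d - j) z\<close>, while the right-hand side collects those
  of the weighted permutation count.
\<close>

lemma R_num_A_num:
  assumes l: "l \<le> d" and j: "j \<le> d" and p: "p \<le> d"
  shows "(\<Sum>i\<le>d. real (R_num i p l) * real ((d - j) choose (d - i))) =
    (\<Sum>i\<le>d. real ((d - i) choose (d - p)) * real (A_num (d + 1) i (d + 1 - j) l))"
  (is "?L p = ?R p")
proof -
  have "(\<Sum>p\<le>d. ?L p * z ^ p) = (\<Sum>p\<le>d. ?R p * z ^ p)" for z :: real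
  proof -
    let ?k = "d + 1 - j"
    have "{v \<in> {1..d + 1}. v < ?k} = {1..d - j}"
      using j by auto
    then have rank: "card {v \<in> {1..d + 1}. v < ?k} = d - j"
      by simp
    have "(\<Sum>p\<le>d. (\<Sum>i\<le>d. real (R_num i p l) * real ((d - j) choose (d - i))) * z ^ p) =
        (\<Sum>i\<le>d. real ((d - j) choose (d - i)) * face_poly l i z)"
      unfolding sum_distrib_right
      by (subst sum.swap) (simp add: face_poly_eq_sum_atMost[of _ d] sum_distrib_left mult_ac)
    also have "\<dots> = (\<Sum>c\<le>d. real ((d - j) choose c) * face_poly l (d - c) z)"
      by (rule sum.reindex_bij_witness[of _ "\<lambda>c. d - c" "\<lambda>i. d - i"]) auto
    also have "\<dots> = last_block_poly l (d + 1) (d - j) z"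
      unfolding last_block_poly_def by (intro sum.mono_neutral_cong_right) auto
    also have "\<dots> = last_weight l z {1..d + 1} (d + 1) ?k"
      using l j rank by (subst last_weight_eq_last_block_poly) auto
    also have "\<dots> = (\<Sum>i\<le>d. real (A_num (d + 1) i ?k l) * (z ^ i * (1 + z) ^ (d - i)))"
      by (rule last_weight_eq_A_num)
    also have "\<dots> = (\<Sum>i\<le>d. real (A_num (d + 1) i ?k l) *
        (\<Sum>p\<le>d. real ((d - i) choose (d - p)) * z ^ p))"
    proof (intro sum.cong refl arg_cong2[where f = "(*)"])
      fix i assume "i \<in> {..d}"
      then have "z ^ i * (1 + z) ^ (d - i) = (\<Sum>c\<le>d - i. real ((d - i) choose c) * z ^ (d - c))"
        using sum_binomial_power_diff[of "d - i" d z] by simp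
      also have "\<dots> = (\<Sum>c\<le>d. real ((d - i) choose c) * z ^ (d - c))"
        by (intro sum.mono_neutral_cong_left) auto
      also have "\<dots> = (\<Sum>p\<le>d. real ((d - i) choose (d - p)) * z ^ p)"
        by (rule sum.reindex_bij_witness[of _ "\<lambda>c. d - c" "\<lambda>i. d - i"]) auto
      finally show "z ^ i * (1 + z) ^ (d - i) = (\<Sum>p\<le>d. real ((d - i) choose (d - p)) * z ^ p)" .
    qed
    also have "\<dots> = (\<Sum>p\<le>d. (\<Sum>i\<le>d. real ((d - i) choose (d - p)) *
        real (A_num (d + 1) i ?k l)) * z ^ p)"
      unfolding sum_distrib_right sum_distrib_left by (subst sum.swap) (simp add: mult_ac)
    finally show ?thesis .
  qed
  then show ?thesis
    using polyfun_eq_coeffs[where c = ?L and d = ?R and n = d] p by blast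
qed

section \<open>Diagonalization of triangular matrices\<close>

lemma similar_mat_if_intertwined:
  fixes A B P :: "'a::field mat"
  assumes A: "A \<in> carrier_mat n n" and B: "B \<in> carrier_mat n n" and P: "P \<in> carrier_mat n n"
    and det: "det P \<noteq> 0" and AP: "A * P = P * B"
  shows "similar_mat A B"
proof -
  from det_non_zero_imp_unit[OF P det] obtain Q where Q: "Q \<in> carrier_mat n n"
    and PQ: "P * Q = 1\<^sub>m n" and QP: "Q * P = 1\<^sub>m n"
    by (auto simp: Units_def ring_mat_def)
  have "P * B * Q = A * (P * Q)"
    using A P Q by (simp add: AP[symmetric] assoc_mult_mat[where ?n\<^sub>1 = n])
  then have "A = P * B * Q"
    using A by (simp add: PQ)
  then show ?thesis
    using A B P Q PQ QP by (intro similar_matI[of A B P Q n]) auto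
qed

lemma prod_list_diag_mat:
  assumes "A \<in> carrier_mat n n"
  shows "prod_list (map f (diag_mat A)) = (\<Prod>i<n. f (A $$ (i, i)))"
  using assms by (simp add: diag_mat_def prod.list_conv_set_nth o_def lessThan_atLeast0)

text \<open>
  For upper triangular \<open>A\<close>, the solution \<open>v\<close> of \<open>A v = A\<^sub>j\<^sub>j v\<close> with \<open>v j = 1\<close> and zero entries
  after \<open>j\<close>, computed from the bottom up.  If the two diagonal entries agree, division by zero gives the entry \<open>0\<close>.
\<close>

function back_subst :: "'a::field mat \<Rightarrow> nat \<Rightarrow> nat \<Rightarrow> 'a" where
  "back_subst A j i =
    (if j < i then 0 else if i = j then 1
     else (\<Sum>k\<in>{i<..j}. A $$ (i, k) * back_subst A j k) / (A $$ (j, j) - A $$ (i, i)))"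

  by pat_completeness auto
termination by (relation "measure (\<lambda>(A, j, i). j - i)") auto

declare back_subst.simps[simp del]

text \<open>
  Row \<open>i < j\<close> of the eigenvector equation is solvable when its diagonal entry differs from the one
  in row \<open>j\<close>; otherwise the hypothesis makes the row trivial, and then the entry \<open>0\<close> that
  division by zero supplies is a solution.
\<close>

lemma back_subst_eigenvector:
  assumes zero: "\<And>i k. k < i \<Longrightarrow> i < n \<Longrightarrow> A $$ (i, k) = 0"
    and eq: "\<And>i k. i < k \<Longrightarrow> k \<le> j \<Longrightarrow> A $$ (i, i) = A $$ (j, j) \<Longrightarrow> A $$ (i, k) = 0"
    and i: "i < n" and j: "j < n"
  shows "(\<Sum>k<n. A $$ (i, k) * back_subst A j k) = back_subst A j i * A $$ (j, j)"
proof -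
  have "(\<Sum>k<n. A $$ (i, k) * back_subst A j k) = (\<Sum>k\<in>{i..j}. A $$ (i, k) * back_subst A j k)"
  proof (rule sum.mono_neutral_right)
    show "\<forall>k\<in>{..<n} - {i..j}. A $$ (i, k) * back_subst A j k = 0"
      using i zero by (auto simp: back_subst.simps[of A j] not_le)
  qed (use j in auto)
  also have "\<dots> = back_subst A j i * A $$ (j, j)"
  proof (cases i j rule: linorder_cases)
    case less
    let ?S = "\<Sum>k\<in>{i<..j}. A $$ (i, k) * back_subst A j k"
    have v: "back_subst A j i = ?S / (A $$ (j, j) - A $$ (i, i))"
      using less by (subst back_subst.simps) simp
    have "{i..j} = insert i {i<..j}"
      using less by auto
    then have split: "(\<Sum>k\<in>{i..j}. A $$ (i, k) * back_subst A j k)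
        = A $$ (i, i) * back_subst A j i + ?S"
      by simp
    show ?thesis
    proof (cases "A $$ (i, i) = A $$ (j, j)")
      case True
      then have "?S = 0"
        using eq by (intro sum.neutral) auto
      then show ?thesis
        by (simp add: split v)
    next
      case False
      then have "?S = back_subst A j i * (A $$ (j, j) - A $$ (i, i))"
        by (simp add: v)
      then show ?thesis
        unfolding split by (simp add: algebra_simps)
    qed
  qed (simp_all add: back_subst.simps)
  finally show ?thesis .
qed

text \<open>
  A triangular matrix with repeated diagonal entries need not be diagonalizable.  Back substitution
  succeeds if, whenever rows \<open>i < j\<close> have equal diagonal entries, row \<open>i\<close> vanishes strictly right of
  the diagonal up to column \<open>j\<close>.
  The eigenvectors found in this way form a unitriangular, hence invertible, matrix.
\<close>

lemma upper_triangular_diagonalizable: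
  fixes A :: "'a::field mat"
  assumes A: "A \<in> carrier_mat n n" and ut: "upper_triangular A"
    and eq: "\<And>i j k. i < k \<Longrightarrow> k \<le> j \<Longrightarrow> j < n \<Longrightarrow> A $$ (i, i) = A $$ (j, j) \<Longrightarrow> A $$ (i, k) = 0"
  shows "diagonalizable A"
proof -
  define P where "P = mat n n (\<lambda>(i, j). back_subst A j i)"
  define D where "D = mat n n (\<lambda>(i, j). if i = j then A $$ (j, j) else 0)"
  have P: "P \<in> carrier_mat n n" and D: "D \<in> carrier_mat n n"
    by (simp_all add: P_def D_def)
  have "upper_triangular P"
    by (auto simp: P_def back_subst.simps)
  then have "det P = (\<Prod>i<n. P $$ (i, i))"
    using det_upper_triangular[OF _ P] prod_list_diag_mat[OF P, of "\<lambda>x. x"] by simp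
  then have det: "det P \<noteq> 0"
    by (simp add: P_def back_subst.simps)
  have "A * P = P * D"
  proof (rule eq_matI)
    fix i j assume "i < dim_row (P * D)" "j < dim_col (P * D)"
    then have ij: "i < n" "j < n"
      by (simp_all add: P_def D_def)
    have "(A * P) $$ (i, j) = (\<Sum>k<n. A $$ (i, k) * back_subst A j k)"
      using A ij by (simp add: P_def scalar_prod_def lessThan_atLeast0)
    also have "\<dots> = back_subst A j i * A $$ (j, j)"
      using A ij ut eq by (intro back_subst_eigenvector) auto
    also have "\<dots> = (P * D) $$ (i, j)"
      using ij by (simp add: P_def D_def scalar_prod_def if_distrib[of "\<lambda>x. _ * x"] sum.delta
          cong: if_cong)
    finally show "(A * P) $$ (i, j) = (P * D) $$ (i, j)" .
  qed (use A P D in auto)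
  then have "similar_mat A D"
    by (rule similar_mat_if_intertwined[OF A D P det])
  moreover have "diagonal_mat D"
    by (simp add: diagonal_mat_def D_def)
  ultimately show ?thesis
    unfolding diagonalizable_def by blast
qed

lemma order_prod_linear:
  fixes a :: "nat \<Rightarrow> 'a::idom"
  shows "order x (\<Prod>i<n. [:- a i, 1:]) = card {i. i < n \<and> a i = x}"
proof -
  have "order x (\<Prod>i<n. [:- a i, 1:]) = (\<Sum>i<n. if a i = x then 1 else 0)"
  proof (induction n)
    case (Suc n)
    have "order x [:- a n, 1:] = (if a n = x then 1 else 0)"
      using order_linear_power[of x "- a n" 1] by auto
    moreover have "order x ((\<Prod>i<n. [:- a i, 1:]) * [:- a n, 1:])
        = order x (\<Prod>i<n. [:- a i, 1:]) + order x [:- a n, 1:]"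
      by (rule order_mult) (simp del: mult_pCons_right)
    ultimately show ?case
      using Suc by (simp del: mult_pCons_right)
  qed simp
  also have "\<dots> = card {i. i < n \<and> a i = x}"
    by (simp add: sum.If_cases Int_def)
  finally show ?thesis .
qed

lemma char_poly_similar_upper_triangular:
  fixes A :: "'a::idom mat"
  assumes A: "A \<in> carrier_mat n n" and ut: "upper_triangular A" and sim: "similar_mat M A"
  shows "char_poly M = (\<Prod>i<n. [:- A $$ (i, i), 1:])"
  using char_poly_similar[OF sim] char_poly_upper_triangular[OF A ut]
    prod_list_diag_mat[OF A, of "\<lambda>a. [:- a, 1:]"] by simp

section \<open>Similarity and spectrum of the subdivision matrices\<close>

text \<open>
  Substituting \<open>x = (x - 1) + 1\<close> in \<open>\<Sum>i. f\<^sub>i\<^sub>-\<^sub>1 (x - 1) ^ (d - i) = \<Sum>j. h\<^sub>j x ^ (d - j)\<close> shows that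
  this matrix turns the h-vector into the f-vector.
\<close>

definition h_to_f_mat :: "nat \<Rightarrow> real mat" where
  "h_to_f_mat d = mat (d + 1) (d + 1) (\<lambda>(i, j). real ((d - j) choose (d - i)))"

lemma F_mat_carrier: "F_mat d l \<in> carrier_mat (d + 1) (d + 1)"
  by (simp add: F_mat_def)

lemma similar_F_mat_H_mat:
  assumes "l \<le> d"
  shows "similar_mat (F_mat d l) (H_mat d l)"
proof (rule similar_mat_if_intertwined)
  show "F_mat d l \<in> carrier_mat (d + 1) (d + 1)" "H_mat d l \<in> carrier_mat (d + 1) (d + 1)"
    and U: "h_to_f_mat d \<in> carrier_mat (d + 1) (d + 1)"
    by (simp_all add: F_mat_def H_mat_def h_to_f_mat_def)
  have "det (h_to_f_mat d) = prod_list (diag_mat (h_to_f_mat d))"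
    by (rule det_lower_triangular[OF _ U]) (auto simp: h_to_f_mat_def)
  also have "\<dots> = (\<Prod>i<d + 1. h_to_f_mat d $$ (i, i))"
    using prod_list_diag_mat[OF U, of "\<lambda>x. x"] by simp
  also have "\<dots> = 1"
    by (simp add: h_to_f_mat_def)
  finally show "det (h_to_f_mat d) \<noteq> 0"
    by simp
  show "F_mat d l * h_to_f_mat d = h_to_f_mat d * H_mat d l"
  proof (rule eq_matI)
    fix p j assume "p < dim_row (h_to_f_mat d * H_mat d l)" "j < dim_col (h_to_f_mat d * H_mat d l)"
    then have pj: "p \<le> d" "j \<le> d"
      by (simp_all add: h_to_f_mat_def H_mat_def)
    have "{0..<d + 1} = {..d}"
      by auto
    then show "(F_mat d l * h_to_f_mat d) $$ (p, j) = (h_to_f_mat d * H_mat d l) $$ (p, j)"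
      using R_num_A_num[OF assms pj(2,1)] pj
      by (simp add: F_mat_def H_mat_def h_to_f_mat_def scalar_prod_def)
  qed (simp_all add: F_mat_def H_mat_def h_to_f_mat_def)
qed

lemma F_mat_upper_triangular: "upper_triangular (F_mat d l)"
  by (auto simp: F_mat_def R_num_eq_0)

lemma F_mat_diag:
  assumes "i \<le> d"
  shows "F_mat d l $$ (i, i) = (if i \<le> l then 1 else fact i / fact l)"
proof -
  have "real (R_num i i l) = fact i / fact l" if "l < i"
    using arg_cong[OF R_num_diag[of l i], of real] that by (simp add: field_simps)
  then show ?thesis
    using assms by (simp add: F_mat_def R_num_small)
qed

text \<open>
  The bound \<open>1 \<le> l\<close> excludes the coincidence \<open>fact 0 = fact 1\<close>.
\<close>

lemma fact_quotient_eq_iff: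
  assumes "1 \<le> l" "l < i"
  shows "fact i / fact l = (fact k / fact l :: real) \<longleftrightarrow> i = k"
proof -
  have "(fact i :: real) \<noteq> fact k" if "i \<noteq> k"
  proof (cases "i < k")
    case True
    then show ?thesis
      using assms fact_less_mono[of i k, where ?'a = real] by simp
  next
    case False
    then show ?thesis
      using assms that by (cases "k = 0")
        (use fact_less_mono[of k i, where ?'a = real] fact_less_mono[of 1 i, where ?'a = real]
          in auto)
  qed
  then show ?thesis
    by auto
qed

lemma F_mat_diag_eq_iff:
  assumes l: "1 \<le> l" and i: "i \<le> d" and k: "k \<le> d"
  shows "F_mat d l $$ (i, i) = F_mat d l $$ (k, k) \<longleftrightarrow> i = k \<or> i \<le> l \<and> k \<le> l"
proof -
  have ne: "fact i / fact l \<noteq> (1 :: real)" if "l < i" for i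
    using fact_quotient_eq_iff[OF l that, of l] that by simp
  show ?thesis
    using i k ne[of i] ne[of k] ne[THEN not_sym, of k] fact_quotient_eq_iff[OF l, of i k]
    by (cases "i \<le> l"; cases "k \<le> l")
      (auto simp: F_mat_diag simp del: divide_eq_1_iff one_eq_divide_iff)
qed

text \<open>
  Equal diagonal entries occur only in the first \<open>l + 1\<close> columns, which are those of the identity
  matrix.
\<close>

lemma diagonalizable_F_mat:
  assumes l: "1 \<le> l"
  shows "diagonalizable (F_mat d l)"
proof (rule upper_triangular_diagonalizable[OF F_mat_carrier F_mat_upper_triangular])
  fix i j k assume "i < k" "k \<le> j" "j < d + 1" "F_mat d l $$ (i, i) = F_mat d l $$ (j, j)"
  then have "k \<le> l" "k \<le> d"
    using F_mat_diag_eq_iff[OF l, of i d j] by auto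
  then show "F_mat d l $$ (i, k) = 0"
    using \<open>i < k\<close> by (simp add: F_mat_def R_num_small)
qed

lemma multiplicity_eigenvalue_similar_F_mat:
  assumes "similar_mat M (F_mat d l)"
  shows "multiplicity_eigenvalue M x = card {i. i < d + 1 \<and> F_mat d l $$ (i, i) = x}"
  unfolding multiplicity_eigenvalue_def
    char_poly_similar_upper_triangular[OF F_mat_carrier F_mat_upper_triangular assms]
  by (rule order_prod_linear)

lemma poly_prod_linear_eq_0_iff:
  fixes a :: "nat \<Rightarrow> 'a::idom"
  shows "poly (\<Prod>i<n. [:- a i, 1:]) x = 0 \<longleftrightarrow> (\<exists>i\<in>{..<n}. a i = x)"
  by (auto simp: poly_prod)

lemma eigenvalue_similar_F_mat:
  assumes "similar_mat M (F_mat d l)"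
  shows "{x. eigenvalue M x} = (\<lambda>i. F_mat d l $$ (i, i)) ` {..<d + 1}"
proof -
  obtain n where M: "M \<in> carrier_mat n n"
    using similar_matD[OF assms] by auto
  show ?thesis
    unfolding eigenvalue_root_char_poly[OF M]
      char_poly_similar_upper_triangular[OF F_mat_carrier F_mat_upper_triangular assms]
      poly_prod_linear_eq_0_iff
    by blast
qed

theorem proposition4p6:
  fixes d l :: nat
  assumes "1 \<le> l" and "l \<le> d - 1"
  shows "similar_mat (F_mat d l) (H_mat d l) \<and>
    (\<forall>M \<in> {F_mat d l, H_mat d l}.
      diagonalizable M \<and>
      {x. eigenvalue M x} = {1} \<union> {fact k / fact l | k. k \<in> {l + 1..d}} \<and>
      multiplicity_eigenvalue M 1 = l + 1 \<and>
      (\<forall>k \<in> {l + 1..d}. multiplicity_eigenvalue M (fact k / fact l) = 1))"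
proof (intro conjI ballI)
  have l: "1 \<le> l" "l < d"
    using assms by auto
  show sim: "similar_mat (F_mat d l) (H_mat d l)"
    using l by (intro similar_F_mat_H_mat) simp
  fix M assume "M \<in> {F_mat d l, H_mat d l}"
  then have M: "similar_mat M (F_mat d l)"
    using similar_mat_refl[OF F_mat_carrier] similar_mat_sym[OF sim] by auto
  have one: "F_mat d l $$ (0, 0) = 1"
    using F_mat_diag[of 0 d l] by simp
  show "diagonalizable M"
    using diagonalizable_F_mat[OF l(1), of d] similar_mat_trans[OF M]
    unfolding diagonalizable_def by blast
  have "{..<d + 1} = {..l} \<union> {l + 1..d}"
    using l by auto
  then have "{x. eigenvalue M x} = (\<lambda>i. F_mat d l $$ (i, i)) ` {..l} \<union>
      (\<lambda>i. F_mat d l $$ (i, i)) ` {l + 1..d}"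
    by (simp only: eigenvalue_similar_F_mat[OF M] image_Un)
  also have "(\<lambda>i. F_mat d l $$ (i, i)) ` {..l} = (\<lambda>i. 1) ` {..l}"
    using l by (intro image_cong) (auto simp: F_mat_diag)
  also have "\<dots> = {1}"
    by auto
  also have "(\<lambda>i. F_mat d l $$ (i, i)) ` {l + 1..d} = (\<lambda>k. fact k / fact l) ` {l + 1..d}"
    by (intro image_cong) (auto simp: F_mat_diag)
  finally show "{x. eigenvalue M x} = {1} \<union> {fact k / fact l | k. k \<in> {l + 1..d}}"
    by (simp add: image_def Bex_def conj_commute)
  have "{i. i < d + 1 \<and> F_mat d l $$ (i, i) = F_mat d l $$ (0, 0)} = {..l}"
    using l F_mat_diag_eq_iff[OF l(1), of _ d 0] by auto
  then show "multiplicity_eigenvalue M 1 = l + 1"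
    using one by (simp add: multiplicity_eigenvalue_similar_F_mat[OF M])
  fix k assume k: "k \<in> {l + 1..d}"
  have "{i. i < d + 1 \<and> F_mat d l $$ (i, i) = F_mat d l $$ (k, k)} = {k}"
    using k F_mat_diag_eq_iff[OF l(1), of _ d k] by auto
  then show "multiplicity_eigenvalue M (fact k / fact l) = 1"
    using k by (simp add: multiplicity_eigenvalue_similar_F_mat[OF M] F_mat_diag)
qed

end
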